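(* Suppose we observe $N\ge1$ independent samples $\widetilde Y_\ell=B+W_\ell$, $\ell=1,\dots,N$, where $W_\ell$ are independent symmetric $n\times n$ noise matrices with i.i.d. entries $(W_{\ell,ij})_{1\le i\le j\le n}$ drawn from $\mathcal{N}(0,\sigma^2)$. Then there exists a universal constant $C>0$ such that for all sufficiently large $n$ and any $m'\in[1,m]$ with $m<n/3$, if $$\beta<\frac{C\sigma\,n^{-1/4}\log^{1/4}\bigl(n/(3m')\bigr)}{\sqrt N},$$ then $$\inf_{\hat\eta\in[0,1]^n}\ \sup_{B\in\mathcal{B}'_S(\beta,n,m)}\ \mathbb{E}_B\|\eta-\hat\eta\|_{\mathrm H}\ \ge\ 4m'\left[\frac18-\exp\Bigl(-\frac{(m-m')^2}{2m}\Bigr)\right].$$ Here the infimum is over all estimators $\hat\eta$ that are measurable functions of $(\widetilde Y_1,\dots,\widetilde Y_N)$ with values in $[0,1]^n$, and $\eta$ is the support indicator of $B$.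
   Context: For a symmetric matrix $B\in\mathbb{R}^{n\times n}$, its node-level support $I_B\subseteq[n]$ is the smallest index set $I$ such that $\|B_{i,\cdot}\|_2>0$ for all $i\in I$ and $B_{ij}=0$ for all $i,j\in I^c$. The support indicator $\eta\in\{0,1\}^n$ of $B$ is $\eta_i=\mathbf 1\{i\in I_B\}$. Parameter class: $$\mathcal{B}'_S(\beta,n,m)=\bigl\{B\in\mathrm{Sym}(n):\ |I_B|\le m,\ |B_{ij}|\ge\beta\ \ \forall i\in I_B,\,j\in I_B^c,\ \ B_{ij}=0\ \ \forall i,j\in I_B^c\bigr\},$$ with $\mathrm{Sym}(n)$ the real symmetric $n\times n$ matrices. Hamming distance: $\|\hat\eta-\eta\|_{\mathrm H}=\sum_{j=1}^n|\hat\eta_j-\eta_j|$. $\mathbb{E}_B$ is the expectation when the signal matrix is $B$. *)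

theory Defs
  imports
    "HOL-Probability.Probability"
    "Jordan_Normal_Form.Matrix"
begin

text \<open>
  Indices run over \<open>{..<n}\<close> instead of \<open>{1..n}\<close>.
\<close>

definition Sym :: "nat \<Rightarrow> real mat set" where
  "Sym n = {B \<in> carrier_mat n n. transpose_mat B = B}"

definition admissible_support :: "real mat \<Rightarrow> nat set \<Rightarrow> bool" where
  "admissible_support B I \<longleftrightarrow>
     I \<subseteq> {..<dim_row B} \<and>
     (\<forall>i\<in>I. L2_set (\<lambda>j. B $$ (i, j)) {..<dim_col B} > 0) \<and>
     (\<forall>i\<in>{..<dim_row B} - I. \<forall>j\<in>{..<dim_row B} - I. B $$ (i, j) = 0)"

text \<open>
  ``Smallest'' refers to cardinality: a least admissible set with respect to inclusion need not
  exist. For a symmetric \<open>B\<close> the set of nonzero rows is admissible, so the minimum is attained.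
  It can be attained by several sets, in which case \<^const>\<open>arg_min\<close> picks one of them; it is unique
  for the members of the parameter class below when \<open>\<beta> > 0\<close> and \<open>m < n / 2\<close>.
\<close>

definition node_support :: "real mat \<Rightarrow> nat set" where
  "node_support B = (ARG_MIN card I. admissible_support B I)"

definition support_indicator :: "real mat \<Rightarrow> nat \<Rightarrow> real" where
  "support_indicator B = indicator (node_support B)"

definition param_class :: "real \<Rightarrow> nat \<Rightarrow> nat \<Rightarrow> real mat set" where
  "param_class \<beta> n m = {B \<in> Sym n.
     card (node_support B) \<le> m \<and>
     (\<forall>i\<in>node_support B. \<forall>j\<in>{..<n} - node_support B. \<bar>B $$ (i, j)\<bar> \<ge> \<beta>) \<and>
     (\<forall>i\<in>{..<n} - node_support B. \<forall>j\<in>{..<n} - node_support B. B $$ (i, j) = 0)}"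

definition hamming :: "nat \<Rightarrow> (nat \<Rightarrow> real) \<Rightarrow> (nat \<Rightarrow> real) \<Rightarrow> real" where
  "hamming n \<eta>' \<eta> = (\<Sum>j<n. \<bar>\<eta>' j - \<eta> j\<bar>)"

text \<open>
  The coordinate \<open>(l, i, j)\<close> is the entry \<open>(i, j)\<close> of the \<open>l\<close>-th matrix. Only the entries of the
  noise with \<open>i \<le> j\<close> are drawn; the others are their mirror images.
\<close>

definition noise :: "nat \<Rightarrow> nat \<Rightarrow> real \<Rightarrow> (nat \<times> nat \<times> nat \<Rightarrow> real) measure" where
  "noise n N \<sigma> =
     Pi\<^sub>M ({..<N} \<times> {(i, j). i \<le> j \<and> j < n}) (\<lambda>_. density lborel (normal_density 0 \<sigma>))"

definition obs_space :: "nat \<Rightarrow> nat \<Rightarrow> (nat \<times> nat \<times> nat \<Rightarrow> real) measure" where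
  "obs_space n N = Pi\<^sub>M ({..<N} \<times> {..<n} \<times> {..<n}) (\<lambda>_. borel)"

definition observe ::
  "nat \<Rightarrow> nat \<Rightarrow> real mat \<Rightarrow> (nat \<times> nat \<times> nat \<Rightarrow> real) \<Rightarrow> (nat \<times> nat \<times> nat \<Rightarrow> real)" where
  "observe n N B w =
     (\<lambda>(l, i, j)\<in>{..<N} \<times> {..<n} \<times> {..<n}. B $$ (i, j) + w (l, min i j, max i j))"

definition obs_law ::
  "nat \<Rightarrow> nat \<Rightarrow> real \<Rightarrow> real mat \<Rightarrow> (nat \<times> nat \<times> nat \<Rightarrow> real) measure" where
  "obs_law n N \<sigma> B = distr (noise n N \<sigma>) (obs_space n N) (observe n N B)"

definition estimators :: "nat \<Rightarrow> nat \<Rightarrow> ((nat \<times> nat \<times> nat \<Rightarrow> real) \<Rightarrow> nat \<Rightarrow> real) set" where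
  "estimators n N = {\<eta>' \<in> obs_space n N \<rightarrow>\<^sub>M Pi\<^sub>M {..<n} (\<lambda>_. borel).
     \<forall>y\<in>space (obs_space n N). \<forall>j<n. \<eta>' y j \<in> {0..1}}"

definition risk ::
  "nat \<Rightarrow> nat \<Rightarrow> real \<Rightarrow> ((nat \<times> nat \<times> nat \<Rightarrow> real) \<Rightarrow> nat \<Rightarrow> real) \<Rightarrow> real mat \<Rightarrow> real" where
  "risk n N \<sigma> \<eta>' B = (\<integral>y. hamming n (\<eta>' y) (support_indicator B) \<partial>obs_law n N \<sigma> B)"

text \<open>
  Taken in \<^typ>\<open>ereal\<close>, so that the infimum and the supremum need no boundedness side conditions.
\<close>

definition minimax_risk :: "nat \<Rightarrow> nat \<Rightarrow> real \<Rightarrow> real \<Rightarrow> nat \<Rightarrow> ereal" where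
  "minimax_risk n N \<sigma> \<beta> m =
     (INF \<eta>' \<in> estimators n N. SUP B \<in> param_class \<beta> n m. ereal (risk n N \<sigma> \<eta>' B))"

end

theory Submission
  imports Defs
begin

text \<open>
  Put a prior on the class: the support \<open>I\<close> contains each node independently with probability
  \<open>p = m' / n\<close>, and the entries meeting \<open>I\<close> off the diagonal, including those inside \<open>I\<close>, are
  independent random signs times \<open>\<beta>\<close>. Reveal \<open>S = I - {j}\<close> to the statistician estimating
  \<open>\<eta>\<^sub>j\<close>: the observed entries meeting \<open>S\<close> then have the same law whether or not \<open>j \<in> I\<close>, and the
  remaining entries of row \<open>j\<close> have likelihood ratio with second moment at most
  \<open>cosh (N \<beta>\<^sup>2 / \<sigma>\<^sup>2) ^ n \<le> exp (n (N \<beta>\<^sup>2 / \<sigma>\<^sup>2)\<^sup>2 / 2)\<close>. At the stated threshold (with \<open>C = 1\<close>)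
  this is at most \<open>1 / (3 p)\<close>, so each node contributes at least \<open>p / 2\<close> to the Bayes risk.
  Truncating the prior to \<open>|I| \<le> m\<close> only loses the configurations with \<open>|S| \<ge> m\<close>, whose
  probability is controlled by a Chernoff bound; no bound on the loss itself is needed there.
\<close>

subsection \<open>Shifts of Gaussian product measures\<close>

text \<open>The density of the normal law \<open>N(b, \<sigma>\<^sup>2)\<close> with respect to \<open>N(0, \<sigma>\<^sup>2)\<close>.\<close>

definition lr :: "real \<Rightarrow> real \<Rightarrow> real \<Rightarrow> real" where
  "lr \<sigma> b x = exp (b * x / \<sigma>\<^sup>2 - b\<^sup>2 / (2 * \<sigma>\<^sup>2))"

lemma lr_nonneg [simp]: "0 \<le> lr \<sigma> b x"
  by (simp add: lr_def)

lemma lr_0 [simp]: "lr \<sigma> 0 x = 1"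
  by (simp add: lr_def)

lemma borel_measurable_lr [measurable]: "lr \<sigma> b \<in> borel_measurable borel"
  unfolding lr_def by measurable

lemma normal_density_times_lr:
  assumes "\<sigma> > 0"
  shows "normal_density 0 \<sigma> x * lr \<sigma> b x = normal_density b \<sigma> x"
proof -
  have "- (x\<^sup>2 / (2 * \<sigma>\<^sup>2)) + (b * x / \<sigma>\<^sup>2 - b\<^sup>2 / (2 * \<sigma>\<^sup>2)) = - ((x - b)\<^sup>2 / (2 * \<sigma>\<^sup>2))"
    using assms by (simp add: field_simps power2_eq_square)
  then show ?thesis
    by (simp add: normal_density_def lr_def flip: exp_add)
qed

text \<open>Completing the square leaves the cross term
  \<open>exp (a * b / \<sigma>\<^sup>2)\<close>. Since each \<open>lr\<close> integrates to 1 under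
  \<open>gauss \<sigma>\<close>, this factor is the inner product of two likelihood ratios, and the
  second moments below all come from it.\<close>

lemma lr_mult: "lr \<sigma> a x * lr \<sigma> b x = exp (a * b / \<sigma>\<^sup>2) * lr \<sigma> (a + b) x"
proof -
  have "(a * x / \<sigma>\<^sup>2 - a\<^sup>2 / (2 * \<sigma>\<^sup>2)) + (b * x / \<sigma>\<^sup>2 - b\<^sup>2 / (2 * \<sigma>\<^sup>2))
      = a * b / \<sigma>\<^sup>2 + ((a + b) * x / \<sigma>\<^sup>2 - (a + b)\<^sup>2 / (2 * \<sigma>\<^sup>2))"
    \<comment> \<open>For \<open>\<sigma> = 0\<close> every quotient is 0 by convention and both
      sides vanish.\<close>
    by (cases "\<sigma> = 0") (simp_all add: field_simps power2_eq_square)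
  then show ?thesis
    by (simp add: lr_def flip: exp_add)
qed

abbreviation gauss :: "real \<Rightarrow> real measure" where
  "gauss \<sigma> \<equiv> density lborel (normal_density 0 \<sigma>)"

lemma integrable_lr:
  assumes "\<sigma> > 0"
  shows "integrable (gauss \<sigma>) (lr \<sigma> b)"
  using assms by (simp add: integrable_real_density normal_density_times_lr)

lemma integral_lr:
  assumes "\<sigma> > 0"
  shows "(\<integral>x. lr \<sigma> b x \<partial>gauss \<sigma>) = 1"
  using assms by (simp add: integral_real_density normal_density_times_lr)

lemma distr_gauss_shift:
  assumes "\<sigma> > 0"
  shows "distr (gauss \<sigma>) borel (\<lambda>x. x + b) = density (gauss \<sigma>) (lr \<sigma> b)"
proof -
  have "distr (gauss \<sigma>) borel (\<lambda>x. x + b) = density lborel (normal_density b \<sigma>)"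
  proof -
    interpret prob_space "gauss \<sigma>"
      using assms by (rule prob_space_normal_density)
    have "distributed (gauss \<sigma>) lborel (\<lambda>x. x) (normal_density 0 \<sigma>)"
      by (simp add: distributed_def distr_id2 measurable_ident_sets)
    then have "distributed (gauss \<sigma>) lborel (\<lambda>x. b + x * 1) (normal_density (b + 0 * 1) (\<bar>1\<bar> * \<sigma>))"
      using assms normal_density_affine[of "\<lambda>x. x" 0 \<sigma> 1 b] by (simp add: mult.commute)
    then show ?thesis
      by (auto simp: distributed_def add.commute cong: distr_cong)
  qed
  also have "\<dots> = density (gauss \<sigma>) (lr \<sigma> b)"
    using assms
    by (simp add: density_density_eq normal_density_times_lr flip: ennreal_mult)
  finally show ?thesis .
qed

text \<open>Both sides equal the product of the one-dimensional laws
  \<open>density (gauss \<sigma>) (lr \<sigma> (b u))\<close>; by \<open>PiM_eqI\<close> it suffices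
  to compare them on boxes.\<close>

lemma distr_PiM_gauss_shift:
  fixes b :: "'i \<Rightarrow> real"
  assumes "finite U" "\<sigma> > 0"
  shows "distr (Pi\<^sub>M U (\<lambda>_. gauss \<sigma>)) (Pi\<^sub>M U (\<lambda>_. borel)) (\<lambda>w. \<lambda>u\<in>U. w u + b u)
       = density (Pi\<^sub>M U (\<lambda>_. gauss \<sigma>)) (\<lambda>x. \<Prod>u\<in>U. lr \<sigma> (b u) (x u))"
    (is "?L = ?R")
proof -
  interpret G: prob_space "gauss \<sigma>"
    using assms by (intro prob_space_normal_density)
  interpret P: product_prob_space "\<lambda>_. gauss \<sigma>" U ..
  have prob: "prob_space (density (gauss \<sigma>) (lr \<sigma> (b u)))" for u
    by (simp flip: distr_gauss_shift[OF \<open>\<sigma> > 0\<close>] add: G.prob_space_distr)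
  interpret Q: product_prob_space "\<lambda>u. density (gauss \<sigma>) (lr \<sigma> (b u))" U
    by (intro product_prob_spaceI prob)
  have "?L = Pi\<^sub>M U (\<lambda>u. density (gauss \<sigma>) (lr \<sigma> (b u)))"
  proof (rule Q.PiM_eqI)
    fix A assume A: "\<And>u. u \<in> U \<Longrightarrow> A u \<in> sets (density (gauss \<sigma>) (lr \<sigma> (b u)))"
    then have A': "\<And>u. u \<in> U \<Longrightarrow> A u \<in> sets borel" by simp
    have pre: "(\<lambda>w. \<lambda>u\<in>U. w u + b u) -` Pi\<^sub>E U A \<inter> space (Pi\<^sub>M U (\<lambda>_. gauss \<sigma>))
        = Pi\<^sub>E U (\<lambda>u. (\<lambda>x. x + b u) -` A u)"
      by (auto simp: space_PiM PiE_iff extensional_def)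
    have m: "(\<lambda>x. x + b u) -` A u \<in> sets borel" if "u \<in> U" for u
      using measurable_sets[of "\<lambda>x. x + b u" borel borel "A u"] A'[OF that] by simp
    have "emeasure ?L (Pi\<^sub>E U A) = emeasure (Pi\<^sub>M U (\<lambda>_. gauss \<sigma>)) (Pi\<^sub>E U (\<lambda>u. (\<lambda>x. x + b u) -` A u))"
      using assms A' by (subst emeasure_distr) (auto simp: pre intro!: sets_PiM_I_finite)
    also have "\<dots> = (\<Prod>u\<in>U. emeasure (gauss \<sigma>) ((\<lambda>x. x + b u) -` A u))"
      using assms m by (subst P.emeasure_PiM) auto
    also have "\<dots> = (\<Prod>u\<in>U. emeasure (distr (gauss \<sigma>) borel (\<lambda>x. x + b u)) (A u))"
      using A' by (intro prod.cong refl) (simp add: emeasure_distr)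
    finally show "emeasure ?L (Pi\<^sub>E U A) = (\<Prod>u\<in>U. emeasure (density (gauss \<sigma>) (lr \<sigma> (b u))) (A u))"
      by (simp add: distr_gauss_shift[OF \<open>\<sigma> > 0\<close>])
  qed (use assms in \<open>auto intro!: sets_PiM_cong\<close>)
  also have "\<dots> = ?R"
  proof (rule Q.PiM_eqI[symmetric])
    fix A assume A: "\<And>u. u \<in> U \<Longrightarrow> A u \<in> sets (density (gauss \<sigma>) (lr \<sigma> (b u)))"
    then have A': "\<And>u. u \<in> U \<Longrightarrow> A u \<in> sets borel" by simp
    have "emeasure ?R (Pi\<^sub>E U A) =
      (\<integral>\<^sup>+x. ennreal (\<Prod>u\<in>U. lr \<sigma> (b u) (x u)) * indicator (Pi\<^sub>E U A) x \<partial>Pi\<^sub>M U (\<lambda>_. gauss \<sigma>))"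
      using assms A' by (subst emeasure_density) (auto intro!: sets_PiM_I_finite)
    also have "\<dots> = (\<integral>\<^sup>+x. (\<Prod>u\<in>U. ennreal (lr \<sigma> (b u) (x u)) * indicator (A u) (x u)) \<partial>Pi\<^sub>M U (\<lambda>_. gauss \<sigma>))"
    proof (rule nn_integral_cong)
      fix x assume "x \<in> space (Pi\<^sub>M U (\<lambda>_. gauss \<sigma>))"
      \<comment> \<open>Extensionality makes membership in the box a matter of the coordinates in
        \<open>U\<close> alone, so its indicator factorises.\<close>
      then have "x \<in> extensional U" by (simp add: space_PiM PiE_def)
      then have "indicator (Pi\<^sub>E U A) x = (\<Prod>u\<in>U. indicator (A u) (x u) :: ennreal)"
        using assms by (auto simp: PiE_iff indicator_def intro!: prod_zero split: if_splits)
      then show "ennreal (\<Prod>u\<in>U. lr \<sigma> (b u) (x u)) * indicator (Pi\<^sub>E U A) x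
          = (\<Prod>u\<in>U. ennreal (lr \<sigma> (b u) (x u)) * indicator (A u) (x u))"
        by (simp add: prod.distrib prod_ennreal)
    qed
    also have "\<dots> = (\<Prod>u\<in>U. \<integral>\<^sup>+x. ennreal (lr \<sigma> (b u) x) * indicator (A u) x \<partial>gauss \<sigma>)"
      using assms A' by (intro P.product_nn_integral_prod) auto
    also have "\<dots> = (\<Prod>u\<in>U. emeasure (density (gauss \<sigma>) (lr \<sigma> (b u))) (A u))"
      using A' by (intro prod.cong refl) (simp add: emeasure_density)
    finally show "emeasure ?R (Pi\<^sub>E U A) = \<dots>" .
  qed (use assms in \<open>auto intro!: sets_PiM_cong\<close>)
  finally show ?thesis .
qed

text \<open>Moves the signal from the argument of \<open>f\<close> into a weight, so that
  expectations under different signals become integrals against one and the same noise law and can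
  be averaged.\<close>

lemma integral_PiM_gauss_shift:
  fixes b :: "'i \<Rightarrow> real" and f :: "('i \<Rightarrow> real) \<Rightarrow> real"
  assumes "finite U" "\<sigma> > 0" and [measurable]: "f \<in> borel_measurable (Pi\<^sub>M U (\<lambda>_. borel))"
  shows "(\<integral>w. f (\<lambda>u\<in>U. w u + b u) \<partial>Pi\<^sub>M U (\<lambda>_. gauss \<sigma>))
       = (\<integral>x. (\<Prod>u\<in>U. lr \<sigma> (b u) (x u)) * f x \<partial>Pi\<^sub>M U (\<lambda>_. gauss \<sigma>))"
proof -
  have "sets (Pi\<^sub>M U (\<lambda>_. gauss \<sigma>)) = sets (Pi\<^sub>M U (\<lambda>_. borel))"
    by (intro sets_PiM_cong) auto
  then have [measurable]: "f \<in> borel_measurable (Pi\<^sub>M U (\<lambda>_. gauss \<sigma>))"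
    by (simp cong: measurable_cong_sets)
  have "(\<integral>w. f (\<lambda>u\<in>U. w u + b u) \<partial>Pi\<^sub>M U (\<lambda>_. gauss \<sigma>))
      = (\<integral>x. f x \<partial>distr (Pi\<^sub>M U (\<lambda>_. gauss \<sigma>)) (Pi\<^sub>M U (\<lambda>_. borel)) (\<lambda>w. \<lambda>u\<in>U. w u + b u))"
    by (subst integral_distr) auto
  also have "\<dots> = (\<integral>x. (\<Prod>u\<in>U. lr \<sigma> (b u) (x u)) * f x \<partial>Pi\<^sub>M U (\<lambda>_. gauss \<sigma>))"
    using assms by (simp add: distr_PiM_gauss_shift integral_real_density prod_nonneg)
  finally show ?thesis .
qed

subsection \<open>Elementary and binomial tail bounds\<close>

text \<open>Integrates the inequality \<open>tanh y \<le> y\<close> between the derivatives of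
  \<open>ln (cosh x)\<close> and \<open>x\<^sup>2 / 2\<close>.\<close>

lemma cosh_le_exp_half_square:
  fixes x :: real
  assumes "x \<ge> 0"
  shows "cosh x \<le> exp (x\<^sup>2 / 2)"
proof -
  have tanh: "tanh y \<le> y" if "y \<ge> 0" for y :: real
  proof -
    \<comment> \<open>The derivative of \<open>y - tanh y\<close> is the square of
      \<open>tanh y\<close>.\<close>
    have "0 - tanh 0 \<le> y - tanh y"
      by (rule DERIV_nonneg_imp_nondecreasing[OF that])
        (auto intro!: derivative_eq_intros exI)
    then show ?thesis by simp
  qed
  have "0\<^sup>2 / 2 - ln (cosh 0) \<le> x\<^sup>2 / 2 - ln (cosh x)"
  proof (rule DERIV_nonneg_imp_nondecreasing[OF assms])
    fix y :: real assume "0 \<le> y"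
    have "((\<lambda>x. x\<^sup>2 / 2 - ln (cosh x)) has_real_derivative y - tanh y) (at y)"
      by (auto intro!: derivative_eq_intros simp: tanh_def)
    with tanh[OF \<open>0 \<le> y\<close>] show "\<exists>z. ((\<lambda>x. x\<^sup>2 / 2 - ln (cosh x)) has_real_derivative z) (at y) \<and> 0 \<le> z"
      by fastforce
  qed
  then show ?thesis
    using exp_le_cancel_iff[of "ln (cosh x)" "x\<^sup>2 / 2"] cosh_real_pos[of x] by simp
qed

text \<open>The two sides agree at 1, and the right side minus the left has derivative
  \<open>- ((1 - y)\<^sup>2 / y)\<close>. The quadratic term becomes the exponent of the Chernoff
  bound, with \<open>2 * m\<close> in the denominator.\<close>

lemma ln_le_quadratic:
  fixes t :: real
  assumes "0 < t" "t \<le> 1"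
  shows "ln t \<le> - (1 - t) - (1 - t)\<^sup>2 / 2"
proof -
  let ?f = "\<lambda>t::real. - (1 - t) - (1 - t)\<^sup>2 / 2 - ln t"
  have "?f 1 \<le> ?f t"
  proof (rule DERIV_nonpos_imp_nonincreasing[OF assms(2)])
    fix y assume y: "t \<le> y" "y \<le> 1"
    have "(?f has_real_derivative 1 + (1 - y) - 1 / y) (at y)"
      using assms y by (auto intro!: derivative_eq_intros simp: field_simps)
    moreover have "1 + (1 - y) - 1 / y = - ((1 - y)\<^sup>2 / y)"
      using assms y by (simp add: field_simps power2_eq_square)
    then have "1 + (1 - y) - 1 / y \<le> 0"
      using assms y by simp
    ultimately show "\<exists>z. (?f has_real_derivative z) (at y) \<and> z \<le> 0"
      by blast
  qed
  then show ?thesis by simp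
qed

text \<open>The binomial theorem indexed by subsets. It gives the total mass of a Bernoulli random
  set for \<open>a = p\<close> and the generating function of its size for \<open>a = p * x\<close>,
  with \<open>b = 1 - p\<close>.\<close>

lemma sum_Pow_card_binomial:
  fixes a b :: "'b :: comm_semiring_1"
  assumes "finite A"
  shows "(\<Sum>S\<in>Pow A. a ^ card S * b ^ (card A - card S)) = (a + b) ^ card A"
proof -
  have "(a + b) ^ card A = (\<Sum>S\<in>Pow A. (\<Prod>x\<in>S. a) * (\<Prod>x\<in>A - S. b))"
    using prod_add[OF assms, of "\<lambda>_. a" "\<lambda>_. b"] by simp
  also have "\<dots> = (\<Sum>S\<in>Pow A. a ^ card S * b ^ (card A - card S))"
    using assms by (intro sum.cong refl) (auto simp: card_Diff_subset finite_subset)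
  finally show ?thesis ..
qed

text \<open>The Chernoff bound for the size of a Bernoulli random subset of \<open>A\<close>. Here
  \<mu> only bounds the mean from above, so that a set of \<open>n - 1\<close> nodes can be treated
  with \<open>\<mu> = n * p\<close>.\<close>

lemma binomial_upper_tail:
  fixes p :: real
  assumes A: "finite A" and p: "0 < p" "p \<le> 1" and \<mu>: "real (card A) * p \<le> \<mu>" "0 < \<mu>" "\<mu> \<le> real m"
  shows "(\<Sum>S | S \<subseteq> A \<and> m \<le> card S. p ^ card S * (1 - p) ^ (card A - card S))
           \<le> exp (- ((real m - \<mu>)\<^sup>2 / (2 * real m)))"
proof -
  \<comment> \<open>\<open>x = e\<^sup>t\<close> for the optimal \<open>t\<close> in the exponential Markov inequality\<close>
  define x where "x = real m / \<mu>"
  have m: "real m > 0" using \<mu> by linarith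
  have x: "x \<ge> 1" using \<mu> by (simp add: x_def)
  have "(\<Sum>S | S \<subseteq> A \<and> m \<le> card S. p ^ card S * (1 - p) ^ (card A - card S))
      \<le> (\<Sum>S | S \<subseteq> A \<and> m \<le> card S. (p * x) ^ card S * (1 - p) ^ (card A - card S) / x ^ m)"
  proof (rule sum_mono)
    fix S assume "S \<in> {S. S \<subseteq> A \<and> m \<le> card S}"
    then have "x ^ m \<le> x ^ card S" using x by (intro power_increasing) auto
    then have "1 \<le> x ^ card S / x ^ m" using x by (simp add: le_divide_eq)
    then have "p ^ card S * (1 - p) ^ (card A - card S) * 1
        \<le> p ^ card S * (1 - p) ^ (card A - card S) * (x ^ card S / x ^ m)"
      using p by (intro mult_left_mono) auto
    then show "p ^ card S * (1 - p) ^ (card A - card S)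
        \<le> (p * x) ^ card S * (1 - p) ^ (card A - card S) / x ^ m"
      by (simp add: power_mult_distrib mult_ac)
  qed
  also have "\<dots> \<le> (\<Sum>S\<in>Pow A. (p * x) ^ card S * (1 - p) ^ (card A - card S) / x ^ m)"
    using A p x by (intro sum_mono2) auto
  also have "\<dots> = (p * x + (1 - p)) ^ card A / x ^ m"
    using sum_Pow_card_binomial[OF A, of "p * x" "1 - p"] by (simp flip: sum_divide_distrib)
  \<comment> \<open>The generating function is bounded by that of a Poisson variable, which is
    monotone in the mean because \<open>x \<ge> 1\<close>.\<close>
  also have "\<dots> \<le> exp (p * (x - 1)) ^ card A / x ^ m"
  proof (intro divide_right_mono power_mono)
    show "p * x + (1 - p) \<le> exp (p * (x - 1))"
      using exp_ge_add_one_self[of "p * (x - 1)"] by (simp add: algebra_simps)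
  qed (use p x in auto)
  also have "\<dots> = exp (real (card A) * p * (x - 1) - real m * ln x)"
    using x by (simp add: exp_diff exp_of_nat_mult mult.assoc)
  also have "\<dots> \<le> exp (\<mu> * (x - 1) - real m * ln x)"
    using \<mu> x by (auto intro!: mult_right_mono)
  also have "\<dots> \<le> exp (- ((real m - \<mu>)\<^sup>2 / (2 * real m)))"
  proof -
    have "real m * ln (\<mu> / real m) \<le> real m * (- (1 - \<mu> / real m) - (1 - \<mu> / real m)\<^sup>2 / 2)"
      using \<mu> m by (intro mult_left_mono ln_le_quadratic) auto
    also have "\<dots> = \<mu> - real m - (real m - \<mu>)\<^sup>2 / (2 * real m)"
      using m by (simp add: field_simps power2_eq_square)
    finally have *: "real m * ln (\<mu> / real m) \<le> \<mu> - real m - (real m - \<mu>)\<^sup>2 / (2 * real m)" .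
    have "ln (\<mu> / real m) = - ln x" using \<mu> m by (simp add: x_def ln_div)
    moreover have "\<mu> * (x - 1) = real m - \<mu>" using \<mu> by (simp add: x_def field_simps)
    ultimately show ?thesis using * by simp
  qed
  finally show ?thesis .
qed

subsection \<open>Mixtures over random signs\<close>

text \<open>Expanding the product of sums gives a sum over choice functions \<open>g\<close>. Each
  summand is a product of functions of separate coordinates, so it integrates factor by factor.
  \<open>L\<close> stands for the samples and \<open>P\<close> for the positions of entries.\<close>

lemma (in prob_space)
  fixes h :: "'e \<Rightarrow> 'w \<Rightarrow> 'a \<Rightarrow> real"
  assumes fin: "finite L" "finite P" "E \<subseteq> P" "finite \<Omega>"
    and int: "\<And>e \<omega>. integrable M (h e \<omega>)"
  shows integrable_PiM_prod_sum_prod: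
      "integrable (Pi\<^sub>M (L \<times> P) (\<lambda>_. M)) (\<lambda>x. \<Prod>e\<in>E. \<Sum>\<omega>\<in>\<Omega>. a * (\<Prod>l\<in>L. h e \<omega> (x (l, e))))"
    and integral_PiM_prod_sum_prod:
      "(\<integral>x. (\<Prod>e\<in>E. \<Sum>\<omega>\<in>\<Omega>. a * (\<Prod>l\<in>L. h e \<omega> (x (l, e)))) \<partial>Pi\<^sub>M (L \<times> P) (\<lambda>_. M))
        = (\<Prod>e\<in>E. \<Sum>\<omega>\<in>\<Omega>. a * (\<integral>x. h e \<omega> x \<partial>M) ^ card L)"
proof -
  interpret P: product_prob_space "\<lambda>_. M" "L \<times> P" ..
  have E: "finite E" using fin finite_subset by blast
  \<comment> \<open>Padding with the constant 1 outside \<open>E\<close> turns each summand into a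
    product over the full index set \<open>L \<times> P\<close>.\<close>
  define k where "k g u = (if snd u \<in> E then h (snd u) (g (snd u)) else (\<lambda>_. 1))" for g and u :: "'b \<times> 'e"
  have k: "integrable M (k g u)" for g u
    using int by (auto simp: k_def)
  have LE: "(\<Prod>e\<in>E. \<Prod>l\<in>L. f l e) = (\<Prod>u\<in>L \<times> P. if snd u \<in> E then f (fst u) (snd u) else (1::real))" for f
  proof -
    have "(\<Prod>u\<in>L \<times> P. if snd u \<in> E then f (fst u) (snd u) else 1) = (\<Prod>u\<in>L \<times> E. f (fst u) (snd u))"
      using fin by (intro prod.mono_neutral_cong_right) auto
    also have "\<dots> = (\<Prod>e\<in>E. \<Prod>l\<in>L. f l e)"
      by (subst prod.swap) (simp add: prod.cartesian_product case_prod_beta)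
    finally show ?thesis ..
  qed
  have eq: "(\<Prod>e\<in>E. \<Sum>\<omega>\<in>\<Omega>. a * (\<Prod>l\<in>L. h e \<omega> (x (l, e))))
      = (\<Sum>g\<in>PiE E (\<lambda>_. \<Omega>). a ^ card E * (\<Prod>u\<in>L \<times> P. k g u (x u)))" for x
  proof -
    have "(\<Prod>e\<in>E. \<Sum>\<omega>\<in>\<Omega>. a * (\<Prod>l\<in>L. h e \<omega> (x (l, e))))
      = (\<Sum>g\<in>PiE E (\<lambda>_. \<Omega>). \<Prod>e\<in>E. a * (\<Prod>l\<in>L. h e (g e) (x (l, e))))"
      using E fin by (intro prod_sum_PiE) auto
    also have "\<dots> = (\<Sum>g\<in>PiE E (\<lambda>_. \<Omega>). a ^ card E * (\<Prod>u\<in>L \<times> P. k g u (x u)))"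
      by (intro sum.cong refl) (simp add: prod.distrib LE k_def if_distrib if_distribR cong: if_cong)
    finally show ?thesis .
  qed
  show "integrable (Pi\<^sub>M (L \<times> P) (\<lambda>_. M)) (\<lambda>x. \<Prod>e\<in>E. \<Sum>\<omega>\<in>\<Omega>. a * (\<Prod>l\<in>L. h e \<omega> (x (l, e))))"
    unfolding eq using fin k by (intro Bochner_Integration.integrable_sum integrable_mult_right P.product_integrable_prod) auto
  have "(\<integral>x. (\<Prod>e\<in>E. \<Sum>\<omega>\<in>\<Omega>. a * (\<Prod>l\<in>L. h e \<omega> (x (l, e)))) \<partial>Pi\<^sub>M (L \<times> P) (\<lambda>_. M))
      = (\<Sum>g\<in>PiE E (\<lambda>_. \<Omega>). a ^ card E * (\<Prod>u\<in>L \<times> P. \<integral>x. k g u x \<partial>M))"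
    unfolding eq using fin k
    by (subst Bochner_Integration.integral_sum)
      (auto intro!: sum.cong integrable_mult_right P.product_integrable_prod simp: P.product_integral_prod)
  also have "\<dots> = (\<Sum>g\<in>PiE E (\<lambda>_. \<Omega>). \<Prod>e\<in>E. a * (\<Prod>l\<in>L. \<integral>x. h e (g e) x \<partial>M))"
    unfolding prod.distrib LE
    by (intro sum.cong refl arg_cong2[where f="(*)"] prod.cong) (auto simp: k_def prob_space)
  also have "\<dots> = (\<Prod>e\<in>E. \<Sum>\<omega>\<in>\<Omega>. a * (\<Prod>l\<in>L. \<integral>x. h e \<omega> x \<partial>M))"
    using E fin by (intro prod_sum_PiE[symmetric]) auto
  finally show "(\<integral>x. (\<Prod>e\<in>E. \<Sum>\<omega>\<in>\<Omega>. a * (\<Prod>l\<in>L. h e \<omega> (x (l, e)))) \<partial>Pi\<^sub>M (L \<times> P) (\<lambda>_. M))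
        = (\<Prod>e\<in>E. \<Sum>\<omega>\<in>\<Omega>. a * (\<integral>x. h e \<omega> x \<partial>M) ^ card L)"
    by simp
qed

text \<open>The pairs are strictly ordered: the diagonal is observed but carries no signal in the
  prior.\<close>

definition edges :: "nat \<Rightarrow> (nat \<times> nat) set" where
  "edges n = {(i, j). i < j \<and> j < n}"

definition incident :: "nat \<Rightarrow> nat set \<Rightarrow> (nat \<times> nat) set" where
  "incident n I = {(i, j) \<in> edges n. i \<in> I \<or> j \<in> I}"

text \<open>
  The likelihood ratio of the \<open>N\<close> observations of the entry \<open>e\<close>, with mean \<open>\<plusminus>\<beta>\<close> of random sign,
  against pure noise.
\<close>

definition sign_mix :: "nat \<Rightarrow> real \<Rightarrow> real \<Rightarrow> nat \<times> nat \<Rightarrow> (nat \<times> nat \<times> nat \<Rightarrow> real) \<Rightarrow> real" where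
  "sign_mix N \<sigma> \<beta> e x = (\<Sum>s\<in>{1, -1}. 1/2 * (\<Prod>l<N. lr \<sigma> (s * \<beta>) (x (l, e))))"

lemma sign_mix_nonneg: "0 \<le> sign_mix N \<sigma> \<beta> e x"
  by (simp add: sign_mix_def prod_nonneg)

lemma finite_upper: "finite {(i, j). i \<le> j \<and> j < (n::nat)}"
  by (rule finite_subset[of _ "{..<n} \<times> {..<n}"]) auto

lemma edges_subset: "edges n \<subseteq> {(i, j). i \<le> j \<and> j < n}"
  by (auto simp: edges_def)

lemma finite_edges [simp]: "finite (edges n)"
  using edges_subset finite_upper finite_subset by blast

lemma incident_subset: "incident n I \<subseteq> edges n"
  by (auto simp: incident_def)

lemma finite_incident [simp]: "finite (incident n I)"
  by (rule finite_subset[OF incident_subset finite_edges])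

text \<open>A mixed moment: second order on \<open>Q\<close>, first order elsewhere. First moments
  are 1. A second moment averages
  \<open>exp (s * s' * N * \<beta>\<^sup>2 / \<sigma>\<^sup>2)\<close> over two independent signs,
  which is the hyperbolic cosine.\<close>

lemma
  assumes \<sigma>: "\<sigma> > 0" and "E \<subseteq> edges n" "Q \<subseteq> E"
  shows integrable_sign_mix:
      "integrable (noise n N \<sigma>) (\<lambda>x. \<Prod>e\<in>E. sign_mix N \<sigma> \<beta> e x ^ (if e \<in> Q then 2 else 1))" (is ?int)
    and integral_sign_mix:
      "(\<integral>x. (\<Prod>e\<in>E. sign_mix N \<sigma> \<beta> e x ^ (if e \<in> Q then 2 else 1)) \<partial>noise n N \<sigma>)
         = cosh (real N * \<beta>\<^sup>2 / \<sigma>\<^sup>2) ^ card Q" (is ?eq)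
proof -
  interpret G: prob_space "gauss \<sigma>"
    using \<sigma> by (rule prob_space_normal_density)
  \<comment> \<open>Pairs of signs serve all edges uniformly; off \<open>Q\<close> the second sign
    does not enter \<open>h\<close>, and averaging over it changes nothing.\<close>
  define \<Omega> where "\<Omega> = {1, -1 :: real} \<times> {1, -1 :: real}"
  define h where "h e \<omega> x = lr \<sigma> (fst \<omega> * \<beta>) x * (if e \<in> Q then lr \<sigma> (snd \<omega> * \<beta>) x else 1)" for e \<omega> x
  have E: "finite E" "E \<subseteq> {(i, j). i \<le> j \<and> j < n}"
    using assms edges_subset[of n] finite_subset[of E "edges n"] by auto
  have h_int: "integrable (gauss \<sigma>) (h e \<omega>)" for e \<omega>
    using \<sigma> integrable_lr[OF \<sigma>] unfolding h_def by (cases "e \<in> Q") (simp_all add: lr_mult)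
  have h_val: "(\<integral>x. h e \<omega> x \<partial>gauss \<sigma>)
      = (if e \<in> Q then exp (fst \<omega> * snd \<omega> * \<beta>\<^sup>2 / \<sigma>\<^sup>2) else 1)" for e \<omega>
    using integral_lr[OF \<sigma>] unfolding h_def
    by (cases "e \<in> Q") (simp_all add: lr_mult power2_eq_square mult_ac)
  have mix: "sign_mix N \<sigma> \<beta> e x ^ (if e \<in> Q then 2 else 1)
      = (\<Sum>\<omega>\<in>\<Omega>. 1/4 * (\<Prod>l<N. h e \<omega> (x (l, e))))" for e x
    unfolding \<Omega>_def sign_mix_def h_def
    by (auto simp: sum.cartesian_product[symmetric] prod.distrib power2_eq_square algebra_simps)
  show ?int
    unfolding mix noise_def using h_int E
    by (intro G.integrable_PiM_prod_sum_prod finite_upper) (auto simp: \<Omega>_def)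
  have "(\<integral>x. (\<Prod>e\<in>E. sign_mix N \<sigma> \<beta> e x ^ (if e \<in> Q then 2 else 1)) \<partial>noise n N \<sigma>)
      = (\<Prod>e\<in>E. \<Sum>\<omega>\<in>\<Omega>. 1/4 * (\<integral>x. h e \<omega> x \<partial>gauss \<sigma>) ^ card {..<N})"
    unfolding mix noise_def using h_int E
    by (intro G.integral_PiM_prod_sum_prod finite_upper) (auto simp: \<Omega>_def)
  also have "\<dots> = (\<Prod>e\<in>E. if e \<in> Q then cosh (real N * \<beta>\<^sup>2 / \<sigma>\<^sup>2) else 1)"
    unfolding h_val
    by (intro prod.cong refl)
      (auto simp: \<Omega>_def sum.cartesian_product[symmetric] cosh_def simp flip: exp_of_nat_mult)
  also have "\<dots> = cosh (real N * \<beta>\<^sup>2 / \<sigma>\<^sup>2) ^ card Q"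
    using E assms by (simp add: prod.If_cases Int_absorb1)
  finally show ?eq .
qed

text \<open>Averaging over independent signs commutes with the product over edges. The signs
  \<open>r\<close> live on all edges, so their range does not depend on \<open>I\<close>; edges not
  meeting \<open>I\<close> have shift 0 and contribute the factor 1.\<close>

lemma average_lr_eq_prod_sign_mix:
  "(\<Sum>r\<in>PiE (edges n) (\<lambda>_. {1, -1}). (1/2) ^ card (edges n) *
      (\<Prod>(l, e)\<in>{..<N} \<times> {(i, j). i \<le> j \<and> j < n}. lr \<sigma> (if e \<in> incident n I then r e * \<beta> else 0) (x (l, e))))
    = (\<Prod>e\<in>incident n I. sign_mix N \<sigma> \<beta> e x)"
proof -
  let ?U = "{..<N} \<times> {(i, j). i \<le> j \<and> j < n}"
  have *: "(\<Prod>(l, e)\<in>?U. lr \<sigma> (if e \<in> incident n I then r e * \<beta> else 0) (x (l, e)))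
    = (\<Prod>e\<in>edges n. \<Prod>l<N. lr \<sigma> (if e \<in> incident n I then r e * \<beta> else 0) (x (l, e)))" for r :: "nat \<times> nat \<Rightarrow> real"
  proof -
    have "(\<Prod>(l, e)\<in>?U. lr \<sigma> (if e \<in> incident n I then r e * \<beta> else 0) (x (l, e)))
      = (\<Prod>(l, e)\<in>{..<N} \<times> edges n. lr \<sigma> (if e \<in> incident n I then r e * \<beta> else 0) (x (l, e)))"
    proof (rule prod.mono_neutral_right)
      show "\<forall>u\<in>?U - {..<N} \<times> edges n.
          (case u of (l, e) \<Rightarrow> lr \<sigma> (if e \<in> incident n I then r e * \<beta> else 0) (x (l, e))) = 1"
        by (auto simp: incident_def split: if_splits)
    qed (use finite_upper edges_subset in auto)
    then show ?thesis
      by (subst prod.swap) (simp add: prod.cartesian_product)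
  qed
  have "(\<Sum>r\<in>PiE (edges n) (\<lambda>_. {1, -1}). (1/2) ^ card (edges n) *
      (\<Prod>(l, e)\<in>?U. lr \<sigma> (if e \<in> incident n I then r e * \<beta> else 0) (x (l, e))))
    = (\<Sum>r\<in>PiE (edges n) (\<lambda>_. {1, -1}). \<Prod>e\<in>edges n. 1/2 *
        (\<Prod>l<N. lr \<sigma> (if e \<in> incident n I then r e * \<beta> else 0) (x (l, e))))"
    unfolding * by (simp only: prod.distrib prod_constant)
  also have "\<dots> = (\<Prod>e\<in>edges n. \<Sum>s\<in>{1, -1}. 1/2 *
        (\<Prod>l<N. lr \<sigma> (if e \<in> incident n I then s * \<beta> else 0) (x (l, e))))"
    by (intro prod_sum_PiE[symmetric]) auto
  also have "\<dots> = (\<Prod>e\<in>incident n I. sign_mix N \<sigma> \<beta> e x)"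
    using incident_subset by (intro prod.mono_neutral_cong_right) (auto simp: sign_mix_def)
  finally show ?thesis .
qed

section \<open>Testing the membership of one node\<close>

text \<open>With \<open>u = \<alpha>' * G\<close>, the left side lies below both \<alpha>, by
  completing a square, and \<open>u\<close>. Hence it lies below their convex combination with
  weights \<open>t\<close> and \<open>1 - t\<close>. This replaces a minimum by first and second
  moments of \<open>G\<close>.\<close>

lemma testing_pointwise:
  fixes \<alpha> \<alpha>' G t :: real
  assumes "0 < \<alpha>" "0 \<le> \<alpha>'" "0 \<le> G" "0 \<le> t" "t \<le> 1"
  shows "\<alpha>' * G - (\<alpha>' * G)\<^sup>2 / (4 * \<alpha>) \<le> \<alpha> * t + \<alpha>' * G * (1 - t)"
proof -
  have "0 \<le> (\<alpha>' * G - 2 * \<alpha>)\<^sup>2 / (4 * \<alpha>)" using assms by simp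
  also have "\<dots> = (\<alpha>' * G)\<^sup>2 / (4 * \<alpha>) - \<alpha>' * G + \<alpha>"
    using assms by (simp add: field_simps power2_eq_square)
  finally have *: "\<alpha>' * G - (\<alpha>' * G)\<^sup>2 / (4 * \<alpha>) \<le> \<alpha>" by simp
  moreover define z where "z = \<alpha>' * G - (\<alpha>' * G)\<^sup>2 / (4 * \<alpha>)"
  moreover have "z \<le> \<alpha>' * G" using assms by (simp add: z_def)
  ultimately have "t * z + (1 - t) * z \<le> t * \<alpha> + (1 - t) * (\<alpha>' * G)"
    using assms by (intro add_mono mult_left_mono) auto
  then have "z \<le> \<alpha> * t + \<alpha>' * G * (1 - t)" by (simp add: algebra_simps)
  then show ?thesis by (simp add: z_def)
qed

lemma integrable_mult_bounded:
  fixes f g :: "'a \<Rightarrow> real"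
  assumes f: "integrable M f" and [measurable]: "g \<in> borel_measurable M"
    and g: "\<And>x. x \<in> space M \<Longrightarrow> \<bar>g x\<bar> \<le> c"
  shows "integrable M (\<lambda>x. f x * g x)"
proof (rule Bochner_Integration.integrable_bound)
  show "integrable M (\<lambda>x. c * f x)" using f by simp
  show "AE x in M. norm (f x * g x) \<le> norm (c * f x)"
  proof (rule AE_I2)
    fix x assume "x \<in> space M"
    from g[OF this] have "\<bar>f x\<bar> * \<bar>g x\<bar> \<le> \<bar>f x\<bar> * \<bar>c\<bar>" by (intro mult_left_mono) auto
    then show "norm (f x * g x) \<le> norm (c * f x)" by (simp add: abs_mult mult.commute)
  qed
qed (use borel_measurable_integrable[OF f] in measurable)

text \<open>\<open>T\<close> estimates the indicator of \<open>j\<close> when the rest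
  \<open>S\<close> of the support is known; \<alpha> and \<alpha>' weigh the two kinds of error. The
  likelihood splits as \<open>F * G\<close>, with \<open>F\<close> common to both hypotheses. The
  bound follows on weighting \<open>testing_pointwise\<close> by \<open>F\<close> and
  integrating.\<close>

lemma two_point_bound:
  assumes \<sigma>: "\<sigma> > 0" and S: "S \<subseteq> {..<n}" "j < n" "j \<notin> S" and \<alpha>: "0 < \<alpha>" "0 \<le> \<alpha>'"
    and T[measurable]: "T \<in> borel_measurable (noise n N \<sigma>)"
    and T01: "\<And>x. x \<in> space (noise n N \<sigma>) \<Longrightarrow> T x \<in> {0..1}"
  shows "\<alpha>' - \<alpha>'\<^sup>2 / (4 * \<alpha>) * cosh (real N * \<beta>\<^sup>2 / \<sigma>\<^sup>2) ^ n
     \<le> \<alpha> * (\<integral>x. (\<Prod>e\<in>incident n S. sign_mix N \<sigma> \<beta> e x) * T x \<partial>noise n N \<sigma>)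
       + \<alpha>' * (\<integral>x. (\<Prod>e\<in>incident n (insert j S). sign_mix N \<sigma> \<beta> e x) * (1 - T x) \<partial>noise n N \<sigma>)"
proof -
  define E where "E = incident n (insert j S)"
  \<comment> \<open>\<open>Q\<close> consists of the edges from \<open>j\<close> to the outside of \<open>S\<close>, the only ones carrying information on \<open>j\<close>.\<close>
  define Q where "Q = E - incident n S"
  define F where "F x = (\<Prod>e\<in>incident n S. sign_mix N \<sigma> \<beta> e x)" for x
  define G where "G x = (\<Prod>e\<in>Q. sign_mix N \<sigma> \<beta> e x)" for x
  have sub: "incident n S \<subseteq> E" "E \<subseteq> edges n" "Q \<subseteq> E" "finite E"
    by (auto simp: E_def Q_def incident_subset) (auto simp: incident_def)
  have FG: "(\<Prod>e\<in>E. sign_mix N \<sigma> \<beta> e x) = F x * G x" for x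
    unfolding F_def G_def Q_def using sub by (metis mult.commute prod.subset_diff)
  have FG2: "(\<Prod>e\<in>E. sign_mix N \<sigma> \<beta> e x ^ (if e \<in> Q then 2 else 1)) = F x * (G x)\<^sup>2" for x
  proof -
    have "(\<Prod>e\<in>E. sign_mix N \<sigma> \<beta> e x ^ (if e \<in> Q then 2 else 1))
      = (\<Prod>e\<in>Q. sign_mix N \<sigma> \<beta> e x ^ (if e \<in> Q then 2 else 1)) *
        (\<Prod>e\<in>incident n S. sign_mix N \<sigma> \<beta> e x ^ (if e \<in> Q then 2 else 1))"
      unfolding Q_def using sub by (intro prod.subset_diff) auto
    also have "(\<Prod>e\<in>incident n S. sign_mix N \<sigma> \<beta> e x ^ (if e \<in> Q then 2 else 1)) = F x"
      unfolding F_def by (intro prod.cong) (auto simp: Q_def)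
    finally show ?thesis by (simp add: G_def prod_power_distrib)
  qed
  have intF: "integrable (noise n N \<sigma>) F"
    unfolding F_def using integrable_sign_mix[OF \<sigma> incident_subset, of "{}"] by simp
  have intFG: "integrable (noise n N \<sigma>) (\<lambda>x. F x * G x)" "(\<integral>x. F x * G x \<partial>noise n N \<sigma>) = 1"
    unfolding FG[symmetric]
    using integrable_sign_mix[OF \<sigma> sub(2), of "{}"] integral_sign_mix[OF \<sigma> sub(2), of "{}"] by simp_all
  have intFG2: "integrable (noise n N \<sigma>) (\<lambda>x. F x * (G x)\<^sup>2)"
    "(\<integral>x. F x * (G x)\<^sup>2 \<partial>noise n N \<sigma>) = cosh (real N * \<beta>\<^sup>2 / \<sigma>\<^sup>2) ^ card Q"
    unfolding FG2[symmetric] using integrable_sign_mix[OF \<sigma> sub(2,3)] integral_sign_mix[OF \<sigma> sub(2,3)] by simp_all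
  \<comment> \<open>Every edge in \<open>Q\<close> contains \<open>j\<close>, so it is determined by
    its other endpoint.\<close>
  have "card Q \<le> n"
  proof -
    have "Q \<subseteq> (\<lambda>i. (min i j, max i j)) ` {..<n}"
      by (force simp: Q_def E_def incident_def edges_def image_iff min_def max_def)
    then show ?thesis
      by (metis card_lessThan finite_lessThan surj_card_le)
  qed
  then have K: "cosh (real N * \<beta>\<^sup>2 / \<sigma>\<^sup>2) ^ card Q \<le> cosh (real N * \<beta>\<^sup>2 / \<sigma>\<^sup>2) ^ n"
    by (intro power_increasing cosh_real_ge_1)
  have FG0: "0 \<le> F x" "0 \<le> G x" for x
    by (simp_all add: F_def G_def prod_nonneg sign_mix_nonneg)
  have FT: "integrable (noise n N \<sigma>) (\<lambda>x. F x * T x)"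
    using T01 by (intro integrable_mult_bounded[OF intF, where c = 1]) auto
  have FGT: "integrable (noise n N \<sigma>) (\<lambda>x. F x * G x * (1 - T x))"
    using T01 by (intro integrable_mult_bounded[OF intFG(1), where c = 1]) auto
  have "\<alpha>' - \<alpha>'\<^sup>2 / (4 * \<alpha>) * cosh (real N * \<beta>\<^sup>2 / \<sigma>\<^sup>2) ^ n
      \<le> \<alpha>' - \<alpha>'\<^sup>2 / (4 * \<alpha>) * cosh (real N * \<beta>\<^sup>2 / \<sigma>\<^sup>2) ^ card Q"
    using K \<alpha> by (intro diff_left_mono mult_left_mono) auto
  also have "\<dots> = (\<integral>x. \<alpha>' * (F x * G x) - \<alpha>'\<^sup>2 / (4 * \<alpha>) * (F x * (G x)\<^sup>2) \<partial>noise n N \<sigma>)"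
    using intFG intFG2 by simp
  also have "\<dots> \<le> (\<integral>x. \<alpha> * (F x * T x) + \<alpha>' * (F x * G x * (1 - T x)) \<partial>noise n N \<sigma>)"
  proof (rule integral_mono)
    fix x assume x: "x \<in> space (noise n N \<sigma>)"
    have "F x * (\<alpha>' * G x - (\<alpha>' * G x)\<^sup>2 / (4 * \<alpha>)) \<le> F x * (\<alpha> * T x + \<alpha>' * G x * (1 - T x))"
      using T01[OF x] \<alpha> FG0 by (intro mult_left_mono testing_pointwise) auto
    then show "\<alpha>' * (F x * G x) - \<alpha>'\<^sup>2 / (4 * \<alpha>) * (F x * (G x)\<^sup>2)
        \<le> \<alpha> * (F x * T x) + \<alpha>' * (F x * G x * (1 - T x))"
      by (simp add: algebra_simps power2_eq_square)
  qed (intro Bochner_Integration.integrable_diff Bochner_Integration.integrable_add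
      integrable_mult_right intFG intFG2 FT FGT)+
  also have "\<dots> = \<alpha> * (\<integral>x. F x * T x \<partial>noise n N \<sigma>) + \<alpha>' * (\<integral>x. F x * G x * (1 - T x) \<partial>noise n N \<sigma>)"
    using FT FGT by simp
  finally show ?thesis unfolding FG[symmetric] by (simp add: F_def E_def)
qed

subsection \<open>The least favourable matrices and their risk\<close>

text \<open>Entries with both indices in \<open>I\<close> also carry signs. Hence an entry joining
  \<open>j\<close> to a member of \<open>S\<close> has the same law for the supports
  \<open>S\<close> and \<open>insert j S\<close>, and reveals nothing about
  \<open>j\<close>.\<close>

definition signal :: "nat \<Rightarrow> real \<Rightarrow> nat set \<Rightarrow> (nat \<times> nat \<Rightarrow> real) \<Rightarrow> real mat" where
  "signal n \<beta> I r = mat n n (\<lambda>(i, j).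
     if (min i j, max i j) \<in> incident n I then r (min i j, max i j) * \<beta> else 0)"

text \<open>
  Recovers the full observation from the entries with \<open>i \<le> j\<close>, so that changes of measure can be
  carried out on the independent coordinates of \<^const>\<open>noise\<close>.
\<close>

definition mirror_obs :: "nat \<Rightarrow> nat \<Rightarrow> (nat \<times> nat \<times> nat \<Rightarrow> real) \<Rightarrow> (nat \<times> nat \<times> nat \<Rightarrow> real)" where
  "mirror_obs n N x = (\<lambda>(l, i, j)\<in>{..<N} \<times> {..<n} \<times> {..<n}. x (l, min i j, max i j))"

lemma signal_eq_0_iff:
  assumes "i < n" "j < n" "\<beta> \<noteq> 0" "r \<in> PiE (edges n) (\<lambda>_. {1, -1})"
  shows "signal n \<beta> I r $$ (i, j) = 0 \<longleftrightarrow> i = j \<or> i \<notin> I \<and> j \<notin> I"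
proof -
  have "r (min i j, max i j) \<in> {1, -1}" if "i \<noteq> j"
    using assms that by (intro PiE_mem[OF assms(4)]) (auto simp: edges_def)
  then show ?thesis
    using assms by (auto simp: signal_def incident_def edges_def min_def max_def)
qed

lemma abs_signal:
  assumes "i < n" "j < n" "r \<in> PiE (edges n) (\<lambda>_. {1, -1})" "i \<in> I" "j \<notin> I"
  shows "\<bar>signal n \<beta> I r $$ (i, j)\<bar> = \<bar>\<beta>\<bar>"
proof -
  have "r (min i j, max i j) \<in> {1, -1}"
    using assms by (intro PiE_mem[OF assms(3)]) (auto simp: edges_def min_def max_def)
  then show ?thesis
    using assms by (auto simp: signal_def incident_def edges_def min_def max_def abs_mult)
qed

text \<open>An admissible set missing some node of \<open>I\<close> must contain the whole
  complement of \<open>I\<close>, whose size exceeds \<open>card I\<close>. So a minimiser contains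
  \<open>I\<close>, and by cardinality equals it.\<close>

lemma node_support_signal:
  assumes I: "I \<subseteq> {..<n}" "2 * card I < n" and \<beta>: "\<beta> \<noteq> 0"
    and r: "r \<in> PiE (edges n) (\<lambda>_. {1, -1})"
  shows "node_support (signal n \<beta> I r) = I"
proof -
  let ?B = "signal n \<beta> I r"
  have dim [simp]: "dim_row ?B = n" "dim_col ?B = n"
    by (simp_all add: signal_def)
  have fin: "finite I" using I(1) finite_subset by blast
  have zero: "?B $$ (i, j) = 0 \<longleftrightarrow> i = j \<or> i \<notin> I \<and> j \<notin> I" if "i < n" "j < n" for i j
    using signal_eq_0_iff[OF that \<beta> r] .
  have co: "card ({..<n} - I) = n - card I"
    using I fin by (simp add: card_Diff_subset)
  have adm: "admissible_support ?B I"
    unfolding admissible_support_def dim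
  proof (intro conjI ballI I(1))
    fix i assume i: "i \<in> I"
    have "{..<n} - I \<noteq> {}" using co I(2) by (metis card.empty diff_is_0_eq le_antisym less_imp_le_nat linorder_not_le mult_2 trans_le_add1)
    then obtain j where j: "j < n" "j \<notin> I" by auto
    have "?B $$ (i, j) \<noteq> 0" using zero[of i j] i j I(1) by auto
    then have "L2_set (\<lambda>j. ?B $$ (i, j)) {..<n} \<noteq> 0"
      using j by (auto simp: L2_set_eq_0_iff)
    then show "0 < L2_set (\<lambda>j. ?B $$ (i, j)) {..<n}"
      using L2_set_nonneg[of "\<lambda>j. ?B $$ (i, j)" "{..<n}"] by linarith
  qed (use zero in auto)
  define J where "J = node_support ?B"
  have J: "admissible_support ?B J" "card J \<le> card I"
    unfolding J_def node_support_def
    using arg_min_natI[of "admissible_support ?B", OF adm] arg_min_nat_le[of "admissible_support ?B", OF adm] by blast+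
  then have Jn: "J \<subseteq> {..<n}" by (simp add: admissible_support_def)
  then have finJ: "finite J" using finite_subset by blast
  have "I \<subseteq> J"
  proof (rule ccontr)
    assume "\<not> I \<subseteq> J"
    then obtain i where i: "i \<in> I" "i \<notin> J" by auto
    have "{..<n} - I \<subseteq> J"
    proof
      fix j assume j: "j \<in> {..<n} - I"
      then have "?B $$ (i, j) \<noteq> 0" using zero[of i j] i I(1) by auto
      then show "j \<in> J" using J(1) i I(1) j by (auto simp: admissible_support_def)
    qed
    then have "n - card I \<le> card J" using card_mono[OF finJ] co by metis
    with J(2) I(2) show False by linarith
  qed
  then show ?thesis
    using card_seteq[OF finJ] J(2) unfolding J_def by auto
qed

lemma signal_in_param_class:
  assumes "I \<subseteq> {..<n}" "card I \<le> m" "2 * m < n" "0 < \<beta>"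
    and "r \<in> PiE (edges n) (\<lambda>_. {1, -1})"
  shows "signal n \<beta> I r \<in> param_class \<beta> n m"
proof -
  have supp: "node_support (signal n \<beta> I r) = I"
    using assms by (intro node_support_signal) auto
  have "signal n \<beta> I r \<in> Sym n"
    by (auto simp: Sym_def signal_def min.commute max.commute)
  moreover have "signal n \<beta> I r $$ (i, j) = 0" if "i < n" "j < n" "i \<notin> I" "j \<notin> I" for i j
    using that assms by (subst signal_eq_0_iff) auto
  moreover have "\<beta> \<le> \<bar>signal n \<beta> I r $$ (i, j)\<bar>" if "i < n" "j < n" "i \<in> I" "j \<notin> I" for i j
    using that assms by (subst abs_signal) auto
  ultimately show ?thesis
    using assms by (auto simp: param_class_def supp)
qed

text \<open>Reduces the lower bound to the threshold value of \<beta>, which is positive as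
  \<open>signal_in_param_class\<close> requires; smaller values, including those at most 0,
  follow.\<close>

lemma param_class_antimono: "\<beta> \<le> \<beta>' \<Longrightarrow> param_class \<beta>' n m \<subseteq> param_class \<beta> n m"
  by (auto simp: param_class_def intro: order.trans[of \<beta> \<beta>'])

section \<open>Measurability, and the risk as an integral over pure noise\<close>

lemma sets_noise: "sets (noise n N \<sigma>) = sets (Pi\<^sub>M ({..<N} \<times> {(i, j). i \<le> j \<and> j < n}) (\<lambda>_. borel))"
  unfolding noise_def by (intro sets_PiM_cong) auto

lemma measurable_mirror_obs:
  "mirror_obs n N \<in> Pi\<^sub>M ({..<N} \<times> {(i, j). i \<le> j \<and> j < n}) (\<lambda>_. borel) \<rightarrow>\<^sub>M obs_space n N"
  unfolding mirror_obs_def obs_space_def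
  by (intro measurable_restrict) (auto intro!: measurable_component_singleton)

lemma measurable_shift:
  "(\<lambda>w. \<lambda>u\<in>U. w u + b u) \<in> Pi\<^sub>M U (\<lambda>_. borel) \<rightarrow>\<^sub>M Pi\<^sub>M U (\<lambda>_. borel :: real measure)"
  by (intro measurable_restrict) auto

lemma observe_eq_mirror_obs:
  "observe n N (signal n \<beta> I r) w =
     mirror_obs n N (\<lambda>(l, e)\<in>{..<N} \<times> {(i, j). i \<le> j \<and> j < n}.
       w (l, e) + (if e \<in> incident n I then r e * \<beta> else 0))"
  by (auto simp: observe_def mirror_obs_def signal_def fun_eq_iff)

lemma measurable_estimator_component:
  assumes "\<eta>' \<in> estimators n N" "j < n"
  shows "(\<lambda>y. \<eta>' y j) \<in> borel_measurable (obs_space n N)"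
  using assms measurable_component_singleton[of j "{..<n}" "\<lambda>_. borel"]
  by (auto simp: estimators_def intro: measurable_compose)

lemma measurable_estimator_mirror_obs:
  assumes "\<eta>' \<in> estimators n N" "j < n"
  shows "(\<lambda>x. \<eta>' (mirror_obs n N x) j) \<in> borel_measurable (noise n N \<sigma>)"
  using measurable_compose[OF measurable_mirror_obs measurable_estimator_component[OF assms]]
  by (simp add: measurable_cong_sets[OF sets_noise refl])

lemma estimator_mirror_obs_range:
  assumes "\<eta>' \<in> estimators n N" "j < n"
  shows "\<eta>' (mirror_obs n N x) j \<in> {0..1}"
proof -
  have "mirror_obs n N x \<in> space (obs_space n N)"
    by (auto simp: mirror_obs_def obs_space_def space_PiM)
  then show ?thesis
    using assms by (simp add: estimators_def)
qed

lemma measurable_hamming_estimator: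
  assumes "\<eta>' \<in> estimators n N"
  shows "(\<lambda>y. hamming n (\<eta>' y) \<eta>) \<in> borel_measurable (obs_space n N)"
  unfolding hamming_def
  by (intro borel_measurable_sum borel_measurable_abs borel_measurable_diff borel_measurable_const
      measurable_estimator_component[OF assms]) simp

text \<open>The observation is \<open>mirror_obs\<close> of a shifted noise vector, so the Gaussian
  shift formula on the independent coordinates applies; \<open>supp\<close> identifies the target of
  the Hamming loss.\<close>

lemma risk_signal:
  assumes "\<sigma> > 0" "\<eta>' \<in> estimators n N" and supp: "node_support (signal n \<beta> I r) = I"
  shows "risk n N \<sigma> \<eta>' (signal n \<beta> I r) =
    (\<integral>x. (\<Prod>(l, e)\<in>{..<N} \<times> {(i, j). i \<le> j \<and> j < n}. lr \<sigma> (if e \<in> incident n I then r e * \<beta> else 0) (x (l, e))) *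
       hamming n (\<eta>' (mirror_obs n N x)) (indicator I) \<partial>noise n N \<sigma>)"
proof -
  let ?U = "{..<N} \<times> {(i, j). i \<le> j \<and> j < n}"
  define b where "b = (\<lambda>(l :: nat, e). if e \<in> incident n I then r e * \<beta> else 0)"
  have obs: "observe n N (signal n \<beta> I r) w = mirror_obs n N (\<lambda>u\<in>?U. w u + b u)" for w
    by (auto simp: observe_eq_mirror_obs b_def case_prod_beta intro!: arg_cong[where f = "mirror_obs n N"])
  have f: "(\<lambda>x. hamming n (\<eta>' (mirror_obs n N x)) (indicator I)) \<in> borel_measurable (Pi\<^sub>M ?U (\<lambda>_. borel))"
    using measurable_compose[OF measurable_mirror_obs measurable_hamming_estimator[OF assms(2)]] .
  have obs_meas: "observe n N (signal n \<beta> I r) \<in> noise n N \<sigma> \<rightarrow>\<^sub>M obs_space n N"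
    unfolding obs measurable_cong_sets[OF sets_noise refl]
    using measurable_compose[OF measurable_shift measurable_mirror_obs] by (simp add: obs[abs_def])
  have "risk n N \<sigma> \<eta>' (signal n \<beta> I r)
      = (\<integral>w. hamming n (\<eta>' (mirror_obs n N (\<lambda>u\<in>?U. w u + b u))) (indicator I) \<partial>noise n N \<sigma>)"
    unfolding risk_def obs_law_def support_indicator_def supp
    by (subst integral_distr[OF obs_meas measurable_hamming_estimator[OF assms(2)]]) (simp add: obs)
  also have "\<dots> = (\<integral>x. (\<Prod>u\<in>?U. lr \<sigma> (b u) (x u)) * hamming n (\<eta>' (mirror_obs n N x)) (indicator I) \<partial>noise n N \<sigma>)"
    unfolding noise_def using assms f finite_upper by (intro integral_PiM_gauss_shift) auto
  finally show ?thesis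
    by (simp add: b_def case_prod_beta)
qed

lemma risk_nonneg: "0 \<le> risk n N \<sigma> \<eta>' B"
  unfolding risk_def by (intro integral_nonneg_AE AE_I2) (simp add: hamming_def sum_nonneg)

text \<open>Linearity moves the average over signs inside the integral, where it turns the
  likelihood ratios into \<open>sign_mix\<close> factors. Integrability holds since each coordinate
  loss is at most 1.\<close>

lemma average_risk_signal:
  assumes \<sigma>: "\<sigma> > 0" and \<eta>': "\<eta>' \<in> estimators n N"
    and supp: "\<And>r. r \<in> PiE (edges n) (\<lambda>_. {1, -1}) \<Longrightarrow> node_support (signal n \<beta> I r) = I"
  shows "(\<Sum>r\<in>PiE (edges n) (\<lambda>_. {1, -1}). (1/2) ^ card (edges n) * risk n N \<sigma> \<eta>' (signal n \<beta> I r))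
    = (\<Sum>j<n. \<integral>x. (\<Prod>e\<in>incident n I. sign_mix N \<sigma> \<beta> e x) * \<bar>\<eta>' (mirror_obs n N x) j - indicator I j\<bar> \<partial>noise n N \<sigma>)"
proof -
  let ?U = "{..<N} \<times> {(i, j). i \<le> j \<and> j < n}"
  let ?R = "PiE (edges n) (\<lambda>_. {1, -1 :: real})"
  interpret G: prob_space "gauss \<sigma>"
    using \<sigma> by (rule prob_space_normal_density)
  interpret P: product_prob_space "\<lambda>_. gauss \<sigma>" ?U ..
  define p where "p r x = (\<Prod>(l, e)\<in>?U. lr \<sigma> (if e \<in> incident n I then r e * \<beta> else 0) (x (l, e)))" for r x
  define d where "d j x = \<bar>\<eta>' (mirror_obs n N x) j - indicator I j\<bar>" for j x
  have d_meas: "d j \<in> borel_measurable (noise n N \<sigma>)" if "j < n" for j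
    unfolding d_def using measurable_estimator_mirror_obs[OF \<eta>' that] by measurable
  have d01: "\<bar>d j x\<bar> \<le> 1" if "j < n" for j x
    using estimator_mirror_obs_range[OF \<eta>' that, of x] by (auto simp: d_def indicator_def)
  have p_int: "integrable (noise n N \<sigma>) (p r)" for r
  proof -
    have "p r = (\<lambda>x. \<Prod>u\<in>?U. lr \<sigma> (if snd u \<in> incident n I then r (snd u) * \<beta> else 0) (x u))"
      unfolding p_def by (intro ext prod.cong refl) auto
    then show ?thesis
      unfolding noise_def using integrable_lr[OF \<sigma>] finite_upper
      by (simp only:) (intro P.product_integrable_prod finite_cartesian_product finite_lessThan)
  qed
  have pd_int: "integrable (noise n N \<sigma>) (\<lambda>x. p r x * d j x)" if "j < n" for r j
    by (rule integrable_mult_bounded[OF p_int d_meas[OF that] d01[OF that]])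
  have mix: "(\<Sum>r\<in>?R. (1/2) ^ card (edges n) * p r x) = (\<Prod>e\<in>incident n I. sign_mix N \<sigma> \<beta> e x)" for x
    unfolding p_def by (rule average_lr_eq_prod_sign_mix)
  have "(\<Sum>r\<in>?R. (1/2) ^ card (edges n) * risk n N \<sigma> \<eta>' (signal n \<beta> I r))
      = (\<Sum>r\<in>?R. \<Sum>j<n. (1/2) ^ card (edges n) * (\<integral>x. p r x * d j x \<partial>noise n N \<sigma>))"
  proof (intro sum.cong refl)
    fix r assume r: "r \<in> ?R"
    have "risk n N \<sigma> \<eta>' (signal n \<beta> I r) = (\<integral>x. (\<Sum>j<n. p r x * d j x) \<partial>noise n N \<sigma>)"
      unfolding risk_signal[OF \<sigma> \<eta>' supp[OF r]] hamming_def sum_distrib_left p_def d_def ..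
    also have "\<dots> = (\<Sum>j<n. \<integral>x. p r x * d j x \<partial>noise n N \<sigma>)"
      using pd_int by (intro Bochner_Integration.integral_sum) auto
    finally show "(1/2) ^ card (edges n) * risk n N \<sigma> \<eta>' (signal n \<beta> I r)
        = (\<Sum>j<n. (1/2) ^ card (edges n) * (\<integral>x. p r x * d j x \<partial>noise n N \<sigma>))"
      by (simp add: sum_distrib_left)
  qed
  also have "\<dots> = (\<Sum>j<n. \<Sum>r\<in>?R. (1/2) ^ card (edges n) * (\<integral>x. p r x * d j x \<partial>noise n N \<sigma>))"
    by (rule sum.swap)
  also have "\<dots> = (\<Sum>j<n. \<integral>x. (\<Prod>e\<in>incident n I. sign_mix N \<sigma> \<beta> e x) * d j x \<partial>noise n N \<sigma>)"
  proof (intro sum.cong refl)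
    fix j assume "j \<in> {..<n}"
    then have int: "integrable (noise n N \<sigma>) (\<lambda>x. (1/2) ^ card (edges n) * (p r x * d j x))" for r
      using pd_int by (intro integrable_mult_right) auto
    have "(\<Sum>r\<in>?R. (1/2) ^ card (edges n) * (\<integral>x. p r x * d j x \<partial>noise n N \<sigma>))
      = (\<integral>x. (\<Sum>r\<in>?R. (1/2) ^ card (edges n) * (p r x * d j x)) \<partial>noise n N \<sigma>)"
      using int by (subst Bochner_Integration.integral_sum) auto
    also have "\<dots> = (\<integral>x. (\<Prod>e\<in>incident n I. sign_mix N \<sigma> \<beta> e x) * d j x \<partial>noise n N \<sigma>)"
      unfolding mix[symmetric] sum_distrib_right mult.assoc ..
    finally show "(\<Sum>r\<in>?R. (1/2) ^ card (edges n) * (\<integral>x. p r x * d j x \<partial>noise n N \<sigma>))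
      = (\<integral>x. (\<Prod>e\<in>incident n I. sign_mix N \<sigma> \<beta> e x) * d j x \<partial>noise n N \<sigma>)" .
  qed
  finally show ?thesis by (simp add: d_def)
qed

subsection \<open>The Bayes risk\<close>

text \<open>The weights may sum to less than 1, as they do for the truncated prior;
  \<open>0 \<le> c\<close> compensates for the missing mass.\<close>

lemma sum_weighted_le:
  fixes w f :: "'a \<Rightarrow> real"
  assumes "\<And>x. x \<in> A \<Longrightarrow> 0 \<le> w x" "sum w A \<le> 1" "\<And>x. x \<in> A \<Longrightarrow> f x \<le> c" "0 \<le> c"
  shows "(\<Sum>x\<in>A. w x * f x) \<le> c"
proof -
  have "(\<Sum>x\<in>A. w x * f x) \<le> (\<Sum>x\<in>A. w x * c)"
    using assms by (intro sum_mono mult_left_mono) auto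
  also have "\<dots> = sum w A * c" by (simp add: sum_distrib_right)
  also have "\<dots> \<le> 1 * c" using assms by (intro mult_right_mono) auto
  finally show ?thesis by simp
qed

text \<open>For each node \<open>j\<close>, the supports are paired as \<open>S\<close> and
  \<open>insert j S\<close>. Every pair costs at least \<open>p / 2\<close> times the prior mass of
  \<open>S\<close>, and the tail bound controls the pairs lost to truncation.\<close>

lemma bernoulli_prior_risk:
  fixes p :: real
  assumes \<sigma>: "\<sigma> > 0" and \<eta>': "\<eta>' \<in> estimators n N" and p: "0 < p" "p < 1"
    and m: "real n * p \<le> real m"
    and K: "p * cosh (real N * \<beta>\<^sup>2 / \<sigma>\<^sup>2) ^ n \<le> 2 * (1 - p)" and n: "n > 0"
  shows "real n * p / 2 * (1 - exp (- ((real m - real n * p)\<^sup>2 / (2 * real m)))) \<le>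
    (\<Sum>I | I \<subseteq> {..<n} \<and> card I \<le> m. p ^ card I * (1 - p) ^ (n - card I) *
      (\<Sum>j<n. \<integral>x. (\<Prod>e\<in>incident n I. sign_mix N \<sigma> \<beta> e x) *
        \<bar>\<eta>' (mirror_obs n N x) j - indicator I j\<bar> \<partial>noise n N \<sigma>))"
proof -
  define w where "w k = p ^ k * (1 - p) ^ (n - k)" for k
  define D where "D j I = (\<integral>x. (\<Prod>e\<in>incident n I. sign_mix N \<sigma> \<beta> e x) *
        \<bar>\<eta>' (mirror_obs n N x) j - indicator I j\<bar> \<partial>noise n N \<sigma>)" for j I
  define X where "X = exp (- ((real m - real n * p)\<^sup>2 / (2 * real m)))"
  define K where "K = cosh (real N * \<beta>\<^sup>2 / \<sigma>\<^sup>2) ^ n"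
  let ?I = "{I. I \<subseteq> {..<n} \<and> card I \<le> m}"
  have D_nonneg: "0 \<le> D j I" for j I
    unfolding D_def by (intro integral_nonneg_AE AE_I2 mult_nonneg_nonneg prod_nonneg sign_mix_nonneg ballI) auto
  have w_pos: "0 < w k" for k using p by (simp add: w_def)
  have node: "p / 2 * (1 - X) \<le> (\<Sum>I\<in>?I. w (card I) * D j I)" if j: "j < n" for j
  proof -
    define A where "A = {..<n} - {j}"
    \<comment> \<open>The law of the support with \<open>j\<close> removed.\<close>
    define v where "v S = p ^ card S * (1 - p) ^ (card A - card S)" for S :: "nat set"
    \<comment> \<open>The inequality is strict so that \<open>insert j S\<close> still has at most
      \<open>m\<close> elements.\<close>
    let ?S = "{S. S \<subseteq> A \<and> card S < m}"
    have A: "finite A" "card A = n - 1" "j \<notin> A" using j by (auto simp: A_def)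
    have finS: "finite S" if "S \<subseteq> A" for S using A that finite_subset by blast
    have fin: "finite ?S" using A by simp
    have cI: "card (insert j S) = Suc (card S)" if "S \<subseteq> A" for S
      using that finS[OF that] A by (subst card_insert_disjoint) auto
    \<comment> \<open>The mean over \<open>n - 1\<close> nodes is bounded by \<open>n * p\<close>,
      which gives the same \<open>X\<close> for every \<open>j\<close>.\<close>
    have "card A * p \<le> real n * p" using p A by simp
    then have tail: "(\<Sum>S | S \<subseteq> A \<and> m \<le> card S. v S) \<le> X"
      unfolding v_def X_def using p A m n by (intro binomial_upper_tail) auto
    have total: "(\<Sum>S\<in>Pow A. v S) = 1"
      unfolding v_def using sum_Pow_card_binomial[OF A(1), of p "1 - p"] by simp
    have "(\<Sum>S\<in>Pow A. v S) = (\<Sum>S\<in>?S \<union> {S. S \<subseteq> A \<and> m \<le> card S}. v S)"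
      by (intro sum.cong refl) auto
    also have "\<dots> = (\<Sum>S\<in>?S. v S) + (\<Sum>S | S \<subseteq> A \<and> m \<le> card S. v S)"
      using A by (intro sum.union_disjoint) auto
    finally have mass: "1 - X \<le> (\<Sum>S\<in>?S. v S)" using tail total by simp
    have pair: "p / 2 * v S \<le> w (card S) * D j S + w (card (insert j S)) * D j (insert j S)" if S: "S \<in> ?S" for S
    proof -
      have SA: "S \<subseteq> A" using S by simp
      have cS: "card S \<le> n - 1" using card_mono[OF A(1) SA] A by simp
      define \<alpha> where "\<alpha> = w (card S)"
      define \<alpha>' where "\<alpha>' = w (Suc (card S))"
      have \<alpha>': "\<alpha>' = p * v S"
        using cS n by (simp add: \<alpha>'_def w_def v_def A)
      have "n - card S = Suc (n - 1 - card S)" using cS n by simp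
      then have \<alpha>: "\<alpha> = (1 - p) * v S"
        by (simp add: \<alpha>_def w_def v_def A)
      have v_pos: "0 < v S" using p by (simp add: v_def)
      have DS: "D j S = (\<integral>x. (\<Prod>e\<in>incident n S. sign_mix N \<sigma> \<beta> e x) * \<eta>' (mirror_obs n N x) j \<partial>noise n N \<sigma>)"
        unfolding D_def using A SA estimator_mirror_obs_range[OF \<eta>' j]
        by (intro Bochner_Integration.integral_cong refl) (auto simp: indicator_def)
      have DjS: "D j (insert j S) = (\<integral>x. (\<Prod>e\<in>incident n (insert j S). sign_mix N \<sigma> \<beta> e x) *
          (1 - \<eta>' (mirror_obs n N x) j) \<partial>noise n N \<sigma>)"
        unfolding D_def using estimator_mirror_obs_range[OF \<eta>' j]
        by (intro Bochner_Integration.integral_cong refl) (auto simp: abs_minus_commute)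
      \<comment> \<open>The assumption amounts to \<open>\<alpha>' * K \<le> 2 * \<alpha>\<close>,
        so the quadratic term in \<open>two_point_bound\<close> consumes at most half of
        \<alpha>'.\<close>
      have "p * K * (v S * p * v S) \<le> 2 * (1 - p) * (v S * p * v S)"
        using K p v_pos by (intro mult_right_mono) (auto simp: K_def)
      then have "\<alpha>'\<^sup>2 * K \<le> 2 * \<alpha> * \<alpha>'"
        using v_pos by (simp add: \<alpha> \<alpha>' power2_eq_square mult_ac)
      then have "\<alpha>'\<^sup>2 / (4 * \<alpha>) * K \<le> \<alpha>' / 2"
        using p v_pos by (simp add: \<alpha> field_simps)
      then have "p / 2 * v S \<le> \<alpha>' - \<alpha>'\<^sup>2 / (4 * \<alpha>) * K" by (simp add: \<alpha>')
      also have "\<dots> \<le> \<alpha> * D j S + \<alpha>' * D j (insert j S)"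
        unfolding DS DjS K_def using \<sigma> SA A j w_pos[of "card S"] w_pos[of "Suc (card S)"]
          measurable_estimator_mirror_obs[OF \<eta>' j] estimator_mirror_obs_range[OF \<eta>' j]
        by (intro two_point_bound) (auto simp: \<alpha>_def \<alpha>'_def A_def)
      finally show ?thesis by (simp add: \<alpha>_def \<alpha>'_def cI[OF SA])
    qed
    have "p / 2 * (1 - X) \<le> p / 2 * (\<Sum>S\<in>?S. v S)"
      using mass p by (intro mult_left_mono) auto
    also have "\<dots> \<le> (\<Sum>S\<in>?S. w (card S) * D j S + w (card (insert j S)) * D j (insert j S))"
      unfolding sum_distrib_left using pair by (intro sum_mono) auto
    also have "\<dots> = (\<Sum>I\<in>?S. w (card I) * D j I) + (\<Sum>I\<in>insert j ` ?S. w (card I) * D j I)"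
    proof -
      have "inj_on (insert j) ?S" using A by (auto simp: inj_on_def insert_ident)
      then show ?thesis by (simp add: sum.distrib sum.reindex)
    qed
    \<comment> \<open>The first family avoids \<open>j\<close> and the second contains it, so no
      support is counted twice.\<close>
    also have "\<dots> = (\<Sum>I\<in>?S \<union> insert j ` ?S. w (card I) * D j I)"
      using A fin by (intro sum.union_disjoint[symmetric]) auto
    also have "\<dots> \<le> (\<Sum>I\<in>?I. w (card I) * D j I)"
    proof (rule sum_mono2)
      show "?S \<union> insert j ` ?S \<subseteq> ?I"
        using j cI by (auto simp: A_def Suc_le_eq)
      show "0 \<le> w (card I) * D j I" for I
        by (rule mult_nonneg_nonneg[OF less_imp_le[OF w_pos] D_nonneg])
    qed simp
    finally show ?thesis .
  qed
  have "real n * p / 2 * (1 - X) = (\<Sum>j<n. p / 2 * (1 - X))" by simp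
  also have "\<dots> \<le> (\<Sum>j<n. \<Sum>I\<in>?I. w (card I) * D j I)"
    using node by (intro sum_mono) auto
  also have "\<dots> = (\<Sum>I\<in>?I. w (card I) * (\<Sum>j<n. D j I))"
    unfolding sum_distrib_left by (rule sum.swap)
  finally show ?thesis by (simp add: X_def w_def D_def)
qed

text \<open>A supremum dominates any average: every real bound \<open>c\<close> on the risks also
  bounds the prior-weighted risk. Nonnegativity of the risk excludes the value minus infinity, and
  plus infinity is trivial.\<close>

lemma SUP_risk_ge:
  fixes p :: real
  assumes \<sigma>: "\<sigma> > 0" and \<eta>': "\<eta>' \<in> estimators n N" and p: "0 < p" "p < 1" and \<beta>: "\<beta> > 0"
    and m: "real n * p \<le> real m" "2 * m < n"
    and K: "p * cosh (real N * \<beta>\<^sup>2 / \<sigma>\<^sup>2) ^ n \<le> 2 * (1 - p)"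
  shows "ereal (real n * p / 2 * (1 - exp (- ((real m - real n * p)\<^sup>2 / (2 * real m)))))
    \<le> (SUP B\<in>param_class \<beta> n m. ereal (risk n N \<sigma> \<eta>' B))" (is "ereal ?L \<le> ?M")
proof -
  let ?I = "{I. I \<subseteq> {..<n} \<and> card I \<le> m}"
  let ?R = "PiE (edges n) (\<lambda>_. {1, -1 :: real})"
  define w where "w k = p ^ k * (1 - p) ^ (n - k)" for k
  define q :: real where "q = (1/2) ^ card (edges n)"
  have R1: "(\<Sum>r\<in>?R. q) = 1"
    by (simp add: q_def card_PiE power_one_over)
  then have "?R \<noteq> {}" by force
  then obtain r0 where r0: "r0 \<in> ?R" by blast
  have cls: "signal n \<beta> I r \<in> param_class \<beta> n m" if "I \<in> ?I" "r \<in> ?R" for I r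
    using that m \<beta> by (intro signal_in_param_class) auto
  \<comment> \<open>The zero matrix shows that the class is nonempty, which yields
    \<open>0 \<le> c\<close> and \<open>0 \<le> ?M\<close>.\<close>
  have B0: "signal n \<beta> {} r0 \<in> param_class \<beta> n m"
    by (rule cls[OF _ r0]) simp
  have avg: "?L \<le> c" if c: "\<And>B. B \<in> param_class \<beta> n m \<Longrightarrow> risk n N \<sigma> \<eta>' B \<le> c" for c
  proof -
    have c0: "0 \<le> c"
      by (rule order_trans[OF risk_nonneg c[OF B0]])
    have "?L \<le> (\<Sum>I\<in>?I. w (card I) * (\<Sum>r\<in>?R. q * risk n N \<sigma> \<eta>' (signal n \<beta> I r)))"
    proof -
      have supp: "node_support (signal n \<beta> I r) = I" if "I \<in> ?I" "r \<in> ?R" for I r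
        using that m \<beta> by (intro node_support_signal) auto
      have "?L \<le> (\<Sum>I\<in>?I. w (card I) *
          (\<Sum>j<n. \<integral>x. (\<Prod>e\<in>incident n I. sign_mix N \<sigma> \<beta> e x) *
            \<bar>\<eta>' (mirror_obs n N x) j - indicator I j\<bar> \<partial>noise n N \<sigma>))"
        unfolding w_def using m by (intro bernoulli_prior_risk[OF \<sigma> \<eta>' p m(1) K]) auto
      also have "\<dots> = (\<Sum>I\<in>?I. w (card I) * (\<Sum>r\<in>?R. q * risk n N \<sigma> \<eta>' (signal n \<beta> I r)))"
        unfolding q_def using supp
        by (intro sum.cong refl arg_cong2[where f = "(*)"] average_risk_signal[OF \<sigma> \<eta>', symmetric]) auto
      finally show ?thesis .
    qed
    also have "\<dots> \<le> c"
    proof (rule sum_weighted_le[OF _ _ _ c0])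
      have "(\<Sum>I\<in>?I. w (card I)) \<le> (\<Sum>I\<in>Pow {..<n}. w (card I))"
        using p by (intro sum_mono2) (auto simp: w_def)
      also have "\<dots> = 1"
        using sum_Pow_card_binomial[of "{..<n}" p "1 - p"] by (simp add: w_def)
      finally show "(\<Sum>I\<in>?I. w (card I)) \<le> 1" .
    next
      fix I assume I: "I \<in> ?I"
      show "(\<Sum>r\<in>?R. q * risk n N \<sigma> \<eta>' (signal n \<beta> I r)) \<le> c"
      proof (rule sum_weighted_le[OF _ _ _ c0])
        show "(\<Sum>r\<in>?R. q) \<le> 1" using R1 by simp
        show "risk n N \<sigma> \<eta>' (signal n \<beta> I r) \<le> c" if "r \<in> ?R" for r
          by (rule c[OF cls[OF I that]])
      qed (simp add: q_def)
    qed (use p in \<open>simp add: w_def\<close>)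
    finally show ?thesis .
  qed
  have upper: "ereal (risk n N \<sigma> \<eta>' B) \<le> ?M" if "B \<in> param_class \<beta> n m" for B
    using that by (rule SUP_upper)
  have "0 \<le> ?M"
    by (rule order_trans[OF _ upper[OF B0]]) (simp add: risk_nonneg)
  then show ?thesis
  proof (cases ?M)
    case (real c)
    then show ?thesis using avg upper by simp
  qed auto
qed

section \<open>Calibration of the signal strength and the prior density\<close>

theorem theorem8:
  shows "\<exists>C::real. C > 0 \<and>
    (\<forall>\<^sub>F n::nat in sequentially.
      \<forall>(N::nat) (\<sigma>::real) (m::nat) (m'::real) (\<beta>::real).
        N \<ge> 1 \<longrightarrow> \<sigma> > 0 \<longrightarrow> m' \<in> {1..real m} \<longrightarrow> real m < real n / 3 \<longrightarrow>
        \<beta> < C * \<sigma> * real n powr (-1/4) * ln (real n / (3 * m')) powr (1/4) / sqrt (real N) \<longrightarrow>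
        minimax_risk n N \<sigma> \<beta> m
          \<ge> ereal (4 * m' * (1/8 - exp (- ((real m - m')\<^sup>2 / (2 * real m))))))"
\<comment> \<open>With \<open>C = 1\<close> the threshold \<beta>' satisfies
  \<open>(N * \<beta>'\<^sup>2 / \<sigma>\<^sup>2)\<^sup>2 = ln y / n\<close>, so the second moment
  of the likelihood ratio is at most \<open>exp (ln y / 2)\<close>, hence at most
  \<open>y\<close>.\<close>
proof (intro exI[of _ 1] conjI always_eventually allI impI)
  fix n N m :: nat and \<sigma> m' \<beta> :: real
  assume N: "N \<ge> 1" and \<sigma>: "\<sigma> > 0" and m': "m' \<in> {1..real m}" and m: "real m < real n / 3"
  define y where "y = real n / (3 * m')"
  define \<beta>' where "\<beta>' = 1 * \<sigma> * real n powr (-1/4) * ln y powr (1/4) / sqrt (real N)"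
  \<comment> \<open>The untruncated prior then has expected support size \<open>m'\<close>.\<close>
  define p where "p = m' / real n"
  define X where "X = exp (- ((real m - m')\<^sup>2 / (2 * real m)))"
  assume "\<beta> < 1 * \<sigma> * real n powr (-1/4) * ln (real n / (3 * m')) powr (1/4) / sqrt (real N)"
  then have \<beta>: "\<beta> \<le> \<beta>'" by (simp add: \<beta>'_def y_def)
  have n: "real n > 0" "n > 0" using m m' by auto
  have y: "1 < y" using m m' n by (simp add: y_def)
  then have lny: "0 < ln y" by simp
  have \<beta>'_pos: "0 < \<beta>'" using N \<sigma> n lny by (simp add: \<beta>'_def)
  have np: "real n * p = m'" using n by (simp add: p_def)
  have py: "p * y = 1 / 3" using n m' by (simp add: p_def y_def)
  have p: "0 < p" "p < 1 / 3" using n m m' by (auto simp: p_def field_simps)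
  have sq: "\<beta>'\<^sup>2 = \<sigma>\<^sup>2 * (real n powr (-1/2) * ln y powr (1/2)) / real N"
    using N by (simp add: \<beta>'_def power_divide power_mult_distrib flip: powr_numeral) (simp add: powr_powr)
  have "cosh (real N * \<beta>'\<^sup>2 / \<sigma>\<^sup>2) ^ n \<le> exp ((real N * \<beta>'\<^sup>2 / \<sigma>\<^sup>2)\<^sup>2 / 2) ^ n"
    by (intro power_mono cosh_le_exp_half_square) auto
  also have "\<dots> = exp (real n * ((real N * \<beta>'\<^sup>2 / \<sigma>\<^sup>2)\<^sup>2 / 2))"
    by (simp only: exp_of_nat_mult)
  also have "(real N * \<beta>'\<^sup>2 / \<sigma>\<^sup>2)\<^sup>2 = ln y / real n"
  proof -
    have "real N * \<beta>'\<^sup>2 / \<sigma>\<^sup>2 = real n powr (-1/2) * ln y powr (1/2)"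
      unfolding sq using N \<sigma> by simp
    also have "\<dots> = sqrt (ln y / real n)"
      using n lny by (simp add: powr_half_sqrt powr_minus_divide real_sqrt_divide)
    finally show ?thesis using n lny by simp
  qed
  also have "exp (real n * (ln y / real n / 2)) \<le> exp (ln y)"
    using n lny by simp
  also have "\<dots> = y" using y by simp
  finally have "p * cosh (real N * \<beta>'\<^sup>2 / \<sigma>\<^sup>2) ^ n \<le> p * y"
    using p by (intro mult_left_mono) auto
  \<comment> \<open>The product \<open>p * y\<close> is 1/3, while \<open>p < 1 / 3\<close> makes
    the right side exceed 4/3.\<close>
  also have "\<dots> \<le> 2 * (1 - p)" unfolding py using p by simp
  finally have K: "p * cosh (real N * \<beta>'\<^sup>2 / \<sigma>\<^sup>2) ^ n \<le> 2 * (1 - p)" .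
  have X: "0 \<le> X" by (simp add: X_def)
  have "m' * X \<ge> 0" using X m' by simp
  \<comment> \<open>Both sides have leading term \<open>m' / 2\<close>; the Bayes bound loses only
    \<open>m' * X / 2\<close>, against \<open>4 * m' * X\<close> in the claim.\<close>
  then have "ereal (4 * m' * (1/8 - X)) \<le> ereal (m' / 2 * (1 - X))"
    by (simp add: algebra_simps)
  also have "\<dots> \<le> minimax_risk n N \<sigma> \<beta> m"
    unfolding minimax_risk_def
  proof (rule INF_greatest)
    fix \<eta>' assume \<eta>': "\<eta>' \<in> estimators n N"
    have "ereal (m' / 2 * (1 - X)) \<le> (SUP B\<in>param_class \<beta>' n m. ereal (risk n N \<sigma> \<eta>' B))"
      using SUP_risk_ge[OF \<sigma> \<eta>' p(1) _ \<beta>'_pos _ _ K, of m] p m m' unfolding np X_def by simp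
    also have "\<dots> \<le> (SUP B\<in>param_class \<beta> n m. ereal (risk n N \<sigma> \<eta>' B))"
      by (rule SUP_subset_mono[OF param_class_antimono[OF \<beta>] order_refl])
    finally show "ereal (m' / 2 * (1 - X)) \<le> (SUP B\<in>param_class \<beta> n m. ereal (risk n N \<sigma> \<eta>' B))" .
  qed
  finally show "ereal (4 * m' * (1/8 - exp (- ((real m - m')\<^sup>2 / (2 * real m))))) \<le> minimax_risk n N \<sigma> \<beta> m"
    by (simp add: X_def)
qed simp

end
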